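(* Let $f,g,h,f_h,D,\mathcal L,p,p_*,r,\psi$ be as in the context. Suppose the following moments over the invariant PDF $p$ of the perturbed system are finite: $$\mathbf E|\mathcal L(\ln r)|<+\infty,\qquad \mathbf E(|h|^2)<+\infty,\qquad \mathbf E(|\psi|^2)<+\infty .$$ Suppose also that the pair $(p,\ln r)$ is $(f_h,D)$-decaying and that the pair $(p_*,r)$ is $(f,D)$-decaying. Then $$\mathbf E\Big(h^{\mathrm T}\psi-\tfrac12|\psi|^2\Big)=0 .$$
   Context: Setting. Let $f\in C^1(\mathbb R^n,\mathbb R^n)$, $g\in C^2(\mathbb R^n,\mathbb R^{n\times m})$, $h\in C^1(\mathbb R^n,\mathbb R^m)$, and $f_h:=f+gh$, all of these maps being Lipschitz. Let $D(x):=g(x)g(x)^{\mathrm T}$ (the diffusion matrix). The nominal system is the Ito SDE $dX_t=f(X_t)\,dt+g(X_t)\,dV_t$ and the perturbed system is $dX_t=f_h(X_t)\,dt+g(X_t)\,dV_t$, with $V$ an $\mathbb R^m$-valued standard Wiener process. For a matrix-valued $G=(G_{jk})\in C^2(\mathbb R^n,\mathbb S_n)$ ($\mathbb S_n$ = real symmetric matrices of order $n$), $\mathrm{div}\,G:=(\sum_k\partial_{x_k}G_{jk})_{1\le j\le n}$ and $\mathrm{div}^2G:=\sum_{j,k}\partial_{x_j}\partial_{x_k}G_{jk}$. For real matrices, $\langle M,N\rangle_{\mathrm F}:=\mathrm{Tr}(M^{\mathrm T}N)$. For $\varphi\in C^2(\mathbb R^n,\mathbb R)$ with gradient $\nabla\varphi$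 and Hessian $\varphi''$, $$\mathcal L(\varphi):=f_h^{\mathrm T}\nabla\varphi+\tfrac12\langle D,\varphi''\rangle_{\mathrm F},\qquad \mathcal L^\dagger(\varphi):=\tfrac12\mathrm{div}^2(\varphi D)-\mathrm{div}(\varphi f_h),$$ and $\mathcal L_*^\dagger(\varphi):=\tfrac12\mathrm{div}^2(\varphi D)-\mathrm{div}(\varphi f)$. Invariant PDFs. $p$ and $p_*$ are the (assumed to exist and to be unique) $C^2$ probability density functions on $\mathbb R^n$ satisfying $\mathcal L^\dagger(p)=0$ (perturbed system) and $\mathcal L_*^\dagger(p_* )=0$ (nominal system); both are assumed positive everywhere. Put $r:=p/p_*$ and $\psi(x):=g(x)^{\mathrm T}\nabla\ln r(x)\in\mathbb R^m$. $\mathbf E(\cdot)$ is the expectation over $p$, i.e. $\mathbf E\varphi=\int_{\mathbb R^n}\varphi(x)p(x)\,dx$. Definition (decaying pair). For $\phi\in C^1(\mathbb R^n,\mathbb R^n)$ and $G\in C^2(\mathbb R^n,\mathbb S_n)$, a pair $(u,v)$ of functions $u,v\in C^2(\mathbb R^n,\mathbb R)$ is called $(\phi,G)$-decaying if $$\Big(\phi-\tfrac12\mathrm{div}\,G\Big)uv+\tfrac12G(u\nabla v-v\nabla u)=o(|x|^{1-n})\quad\text{as }x\to\infty .$$ *)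

theory Defs
  imports "HOL-Analysis.Analysis" "HOL-Library.Landau_Symbols"
begin

definition C1_map :: "('a::real_normed_vector \<Rightarrow> 'b::real_normed_vector) \<Rightarrow> bool" where
  "C1_map F \<longleftrightarrow>
     (\<exists>F'. (\<forall>x. (F has_derivative blinfun_apply (F' x)) (at x)) \<and> continuous_on UNIV F')"

definition C2_map :: "('a::real_normed_vector \<Rightarrow> 'b::real_normed_vector) \<Rightarrow> bool" where
  "C2_map F \<longleftrightarrow>
     (\<exists>F'. (\<forall>x. (F has_derivative blinfun_apply (F' x)) (at x)) \<and> C1_map F')"

definition lipschitz_map :: "('a::metric_space \<Rightarrow> 'b::metric_space) \<Rightarrow> bool" where
  "lipschitz_map F \<longleftrightarrow> (\<exists>C. C-lipschitz_on UNIV F)"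

definition partial_deriv :: "'n \<Rightarrow> (real ^ 'n \<Rightarrow> real) \<Rightarrow> real ^ 'n \<Rightarrow> real" where
  "partial_deriv k \<phi> x = deriv (\<lambda>t. \<phi> (x + t *\<^sub>R axis k 1)) 0"

definition gradient :: "(real ^ 'n \<Rightarrow> real) \<Rightarrow> real ^ 'n \<Rightarrow> real ^ 'n" where
  "gradient \<phi> x = (\<chi> k. partial_deriv k \<phi> x)"

definition hessian :: "(real ^ 'n \<Rightarrow> real) \<Rightarrow> real ^ 'n \<Rightarrow> real ^ 'n ^ 'n" where
  "hessian \<phi> x = (\<chi> j k. partial_deriv j (partial_deriv k \<phi>) x)"

definition vec_div :: "(real ^ 'n \<Rightarrow> real ^ 'n) \<Rightarrow> real ^ 'n \<Rightarrow> real" where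
  "vec_div F x = (\<Sum>k\<in>UNIV. partial_deriv k (\<lambda>y. F y $ k) x)"

definition mat_div :: "(real ^ 'n \<Rightarrow> real ^ 'n ^ 'n) \<Rightarrow> real ^ 'n \<Rightarrow> real ^ 'n" where
  "mat_div G x = (\<chi> j. \<Sum>k\<in>UNIV. partial_deriv k (\<lambda>y. G y $ j $ k) x)"

definition mat_div2 :: "(real ^ 'n \<Rightarrow> real ^ 'n ^ 'n) \<Rightarrow> real ^ 'n \<Rightarrow> real" where
  "mat_div2 G x =
     (\<Sum>j\<in>UNIV. \<Sum>k\<in>UNIV. partial_deriv j (partial_deriv k (\<lambda>y. G y $ j $ k)) x)"

definition frob_inner :: "real ^ 'n ^ 'm \<Rightarrow> real ^ 'n ^ 'm \<Rightarrow> real" where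
  "frob_inner M N = trace (transpose M ** N)"

text \<open>Infinitesimal generator, and its formal adjoint (the Fokker--Planck operator), for drift \<open>b\<close>
  and diffusion matrix \<open>D\<close>.\<close>

definition generator ::
    "(real ^ 'n \<Rightarrow> real ^ 'n) \<Rightarrow> (real ^ 'n \<Rightarrow> real ^ 'n ^ 'n) \<Rightarrow>
     (real ^ 'n \<Rightarrow> real) \<Rightarrow> real ^ 'n \<Rightarrow> real" where
  "generator b D \<phi> x = b x \<bullet> gradient \<phi> x + 1/2 * frob_inner (D x) (hessian \<phi> x)"

definition adjoint_generator ::
    "(real ^ 'n \<Rightarrow> real ^ 'n) \<Rightarrow> (real ^ 'n \<Rightarrow> real ^ 'n ^ 'n) \<Rightarrow>
     (real ^ 'n \<Rightarrow> real) \<Rightarrow> real ^ 'n \<Rightarrow> real" where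
  "adjoint_generator b D \<phi> x =
     1/2 * mat_div2 (\<lambda>y. \<phi> y *\<^sub>R D y) x - vec_div (\<lambda>y. \<phi> y *\<^sub>R b y) x"

definition invariant_pdf ::
    "(real ^ 'n \<Rightarrow> real ^ 'n) \<Rightarrow> (real ^ 'n \<Rightarrow> real ^ 'n ^ 'n) \<Rightarrow> (real ^ 'n \<Rightarrow> real) \<Rightarrow> bool" where
  "invariant_pdf b D p \<longleftrightarrow>
     C2_map p \<and> (\<forall>x. 0 \<le> p x) \<and> has_bochner_integral lborel p 1 \<and>
     (\<forall>x. adjoint_generator b D p x = 0)"

text \<open>The Landau symbols of the library are for field-valued functions, hence the norm of the
  vector field in the last conjunct.\<close>

definition decaying_pair ::
    "(real ^ 'n \<Rightarrow> real ^ 'n) \<Rightarrow> (real ^ 'n \<Rightarrow> real ^ 'n ^ 'n) \<Rightarrow>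
     (real ^ 'n \<Rightarrow> real) \<Rightarrow> (real ^ 'n \<Rightarrow> real) \<Rightarrow> bool" where
  "decaying_pair \<phi> G u v \<longleftrightarrow>
     C1_map \<phi> \<and> C2_map G \<and> (\<forall>x. transpose (G x) = G x) \<and> C2_map u \<and> C2_map v \<and>
     (\<lambda>x. norm ((u x * v x) *\<^sub>R (\<phi> x - (1/2) *\<^sub>R mat_div G x)
              + (1/2) *\<^sub>R (G x *v (u x *\<^sub>R gradient v x - v x *\<^sub>R gradient u x))))
       \<in> o[at_infinity](\<lambda>x. norm x powr (1 - real CARD('n)))"

text \<open>Since the Bochner integral of a non-integrable function is 0, a vanishing \<open>mean\<close> is only
  meaningful together with \<open>mean_finite\<close>.\<close>

definition mean_finite :: "(real ^ 'n \<Rightarrow> real) \<Rightarrow> (real ^ 'n \<Rightarrow> real) \<Rightarrow> bool" where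
  "mean_finite p \<xi> \<longleftrightarrow> integrable lborel (\<lambda>x. \<xi> x * p x)"

definition mean :: "(real ^ 'n \<Rightarrow> real) \<Rightarrow> (real ^ 'n \<Rightarrow> real) \<Rightarrow> real" where
  "mean p \<xi> = (\<integral>x. \<xi> x * p x \<partial>lborel)"

end

(* The combination u L(v) - v L^dagger(u) is the divergence of the field that the
   decay condition controls. A divergence that is integrable over the whole space has integral zero
   as soon as the field is o(|x|^(1-n)): test it against smooth cutoffs, whose gradients live on
   annuli. Applied to (p, ln r) and (p0, r), and combined with
     p L(ln r) = p0 L_0(r) + p (h . psi - |psi|^2 / 2),
   where L_0 is the generator of the nominal system, this gives the claim. Unlike p L(ln r), the
   term p0 L_0(r) is not integrable by assumption; its integrability comes from the moments of h
   and psi. *)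
theory Submission
  imports Defs
begin

section \<open>Partial derivatives and closure properties of C1 and C2 maps\<close>

lemma has_real_derivative_along_axis:
  fixes F :: "real ^ 'n \<Rightarrow> real"
  assumes "(F has_derivative F') (at (x + t *\<^sub>R axis k 1))"
  shows "((\<lambda>s. F (x + s *\<^sub>R axis k 1)) has_real_derivative F' (axis k 1)) (at t)"
proof -
  have "((\<lambda>s. x + s *\<^sub>R axis k (1::real)) has_derivative (\<lambda>s. s *\<^sub>R axis k 1)) (at t)"
    by (auto intro!: derivative_eq_intros)
  from has_derivative_compose[OF this assms]
  have "((\<lambda>s. F (x + s *\<^sub>R axis k 1)) has_derivative (\<lambda>s. F' (s *\<^sub>R axis k 1))) (at t)" .
  moreover have "F' (s *\<^sub>R axis k 1) = F' (axis k 1) * s" for s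
    using linear_cmul[OF has_derivative_linear[OF assms]] by simp
  ultimately show ?thesis by (simp add: has_field_derivative_def)
qed

text \<open>\<open>deriv\<close> says something only where a derivative exists. Through this link
  partial derivatives are read off the Frechet derivative, so their continuity and smoothness follow
  from those of \<open>F'\<close>.\<close>

lemma partial_deriv_eq:
  fixes F :: "real ^ 'n \<Rightarrow> real"
  assumes "(F has_derivative F') (at x)"
  shows "partial_deriv k F x = F' (axis k 1)"
  using has_real_derivative_along_axis[of F F' x 0 k] assms
  by (simp add: partial_deriv_def DERIV_imp_deriv)

lemma C1_mapE:
  assumes "C1_map F"
  obtains F' where "\<And>x. (F has_derivative blinfun_apply (F' x)) (at x)" "continuous_on UNIV F'"
  using assms unfolding C1_map_def by blast

lemma C1_map_imp_continuous: "C1_map F \<Longrightarrow> continuous_on A F"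
  by (metis C1_mapE continuous_at_imp_continuous_on has_derivative_continuous)

text \<open>Stated at every \<open>t\<close>, not just at 0: the calculus rules use
  \<open>t = 0\<close>, while the bound on difference quotients needs the derivative along the whole
  line.\<close>

lemma C1_map_DERIV_along_axis:
  fixes F :: "real ^ 'n \<Rightarrow> real"
  assumes "C1_map F"
  shows "((\<lambda>s. F (x + s *\<^sub>R axis k 1)) has_real_derivative partial_deriv k F (x + t *\<^sub>R axis k 1)) (at t)"
proof -
  obtain F' where F': "\<And>x. (F has_derivative blinfun_apply (F' x)) (at x)"
    using assms by (rule C1_mapE) blast
  show ?thesis
    unfolding partial_deriv_eq[OF F'] by (rule has_real_derivative_along_axis[OF F'])
qed

lemma continuous_on_partial_deriv:
  fixes F :: "real ^ 'n \<Rightarrow> real"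
  assumes "C1_map F"
  shows "continuous_on A (partial_deriv k F)"
proof -
  obtain F' where F': "\<And>x. (F has_derivative blinfun_apply (F' x)) (at x)" "continuous_on UNIV F'"
    using assms by (rule C1_mapE) blast
  have "partial_deriv k F = (\<lambda>x. blinfun_apply (F' x) (axis k 1))"
    using partial_deriv_eq F'(1) by blast
  then show ?thesis
    using F'(2) by (auto intro!: continuous_intros intro: continuous_on_subset)
qed

lemma C1_map_bounded_linear:
  assumes "bounded_linear L" "C1_map F"
  shows "C1_map (\<lambda>x. L (F x))"
proof -
  obtain F' where F': "\<And>x. (F has_derivative blinfun_apply (F' x)) (at x)" "continuous_on UNIV F'"
    using assms(2) by (rule C1_mapE) blast
  have "((\<lambda>x. L (F x)) has_derivative blinfun_apply (Blinfun L o\<^sub>L F' x)) (at x)" for x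
    using bounded_linear.has_derivative[OF assms(1) F'(1)[of x]]
    by (simp add: bounded_linear_Blinfun_apply[OF assms(1)] blinfun_compose.rep_eq comp_def)
  moreover have "continuous_on UNIV (\<lambda>x. Blinfun L o\<^sub>L F' x)"
    using F'(2) by (auto intro!: continuous_intros)
  ultimately show ?thesis
    unfolding C1_map_def by (intro exI[of _ "\<lambda>x. Blinfun L o\<^sub>L F' x"] conjI allI)
qed

lemma C2_map_bounded_linear:
  assumes "bounded_linear L" "C2_map F"
  shows "C2_map (\<lambda>x. L (F x))"
proof -
  obtain F' where F': "\<And>x. (F has_derivative blinfun_apply (F' x)) (at x)" "C1_map F'"
    using assms(2) unfolding C2_map_def by blast
  have "((\<lambda>x. L (F x)) has_derivative blinfun_apply (Blinfun L o\<^sub>L F' x)) (at x)" for x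
    using bounded_linear.has_derivative[OF assms(1) F'(1)[of x]]
    by (simp add: bounded_linear_Blinfun_apply[OF assms(1)] blinfun_compose.rep_eq comp_def)
  \<comment> \<open>Composition with \<open>Blinfun L\<close> is itself bounded linear in
    \<open>F'\<close>, so the C1 statement can be applied one level up.\<close>
  moreover have "C1_map (\<lambda>x. Blinfun L o\<^sub>L F' x)"
    by (rule C1_map_bounded_linear[OF _ F'(2)]) (rule bounded_linear_intros)+
  ultimately show ?thesis
    unfolding C2_map_def by (intro exI[of _ "\<lambda>x. Blinfun L o\<^sub>L F' x"] conjI allI)
qed

lemma C2_map_imp_C1_map: "C2_map F \<Longrightarrow> C1_map F"
  unfolding C2_map_def C1_map_def[of F] using C1_map_imp_continuous by blast

text \<open>Evaluation of the derivative at the fixed vector \<open>axis k 1\<close> is a bounded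
  linear map, and such maps preserve C1.\<close>

lemma C1_map_partial_deriv:
  fixes F :: "real ^ 'n \<Rightarrow> real"
  assumes "C2_map F"
  shows "C1_map (partial_deriv k F)"
proof -
  obtain F' where F': "\<And>x. (F has_derivative blinfun_apply (F' x)) (at x)" "C1_map F'"
    using assms unfolding C2_map_def by blast
  have "partial_deriv k F = (\<lambda>x. blinfun_apply (F' x) (axis k 1))"
    using partial_deriv_eq F'(1) by blast
  then show ?thesis
    using C1_map_bounded_linear[OF _ F'(2), of "\<lambda>A. blinfun_apply A (axis k 1)"]
    by (simp add: bounded_linear_intros)
qed

lemma C1_map_component: "C1_map F \<Longrightarrow> C1_map (\<lambda>x. F x $ k)"
  by (rule C1_map_bounded_linear[OF bounded_linear_vec_nth])

lemma C2_map_component: "C2_map F \<Longrightarrow> C2_map (\<lambda>x. F x $ k)"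
  by (rule C2_map_bounded_linear[OF bounded_linear_vec_nth])

lemma C1_map_const: "C1_map (\<lambda>x. c)"
  unfolding C1_map_def by (rule exI[of _ "\<lambda>x. 0"]) (auto simp: zero_blinfun.rep_eq)

lemma C1_map_add:
  assumes "C1_map F" "C1_map G"
  shows "C1_map (\<lambda>x. F x + G x)"
proof -
  obtain F' where F': "\<And>x. (F has_derivative blinfun_apply (F' x)) (at x)" "continuous_on UNIV F'"
    using assms(1) by (rule C1_mapE) blast
  obtain G' where G': "\<And>x. (G has_derivative blinfun_apply (G' x)) (at x)" "continuous_on UNIV G'"
    using assms(2) by (rule C1_mapE) blast
  show ?thesis
    unfolding C1_map_def using F' G'
    by (intro exI[of _ "\<lambda>x. F' x + G' x"])
      (auto intro!: derivative_eq_intros continuous_intros simp: plus_blinfun.rep_eq)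
qed

lemma C1_map_diff:
  assumes "C1_map F" "C1_map G"
  shows "C1_map (\<lambda>x. F x - G x)"
  using C1_map_add[OF assms(1)
      C1_map_bounded_linear[OF bounded_linear_minus[OF bounded_linear_ident] assms(2)]]
  by simp

lemma C1_map_mult:
  fixes F G :: "'a::real_normed_vector \<Rightarrow> real"
  assumes "C1_map F" "C1_map G"
  shows "C1_map (\<lambda>x. F x * G x)"
proof -
  obtain F' where F': "\<And>x. (F has_derivative blinfun_apply (F' x)) (at x)" "continuous_on UNIV F'"
    using assms(1) by (rule C1_mapE) blast
  obtain G' where G': "\<And>x. (G has_derivative blinfun_apply (G' x)) (at x)" "continuous_on UNIV G'"
    using assms(2) by (rule C1_mapE) blast
  show ?thesis
    unfolding C1_map_def using F' G' C1_map_imp_continuous[OF assms(1)] C1_map_imp_continuous[OF assms(2)]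
    by (intro exI[of _ "\<lambda>x. F x *\<^sub>R G' x + G x *\<^sub>R F' x"])
      (auto intro!: derivative_eq_intros continuous_intros
        simp: plus_blinfun.rep_eq scaleR_blinfun.rep_eq)
qed

lemma C1_map_sum:
  assumes "\<And>i. i \<in> I \<Longrightarrow> C1_map (F i)"
  shows "C1_map (\<lambda>x. \<Sum>i\<in>I. F i x)"
  using assms by (induction I rule: infinite_finite_induct) (auto intro: C1_map_const C1_map_add)

text \<open>The outer function has to be C1 on the whole real line. This fits \<open>exp\<close> and
  the cutoff profile but not \<open>ln\<close>, which is why the density ratio is later treated as
  an exponential.\<close>

lemma C1_map_compose_real:
  fixes F :: "'a::real_normed_vector \<Rightarrow> real"
  assumes "C1_map F" "\<And>s. (q has_real_derivative q' s) (at s)" "continuous_on UNIV q'"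
  shows "C1_map (\<lambda>x. q (F x))"
proof -
  obtain F' where F': "\<And>x. (F has_derivative blinfun_apply (F' x)) (at x)" "continuous_on UNIV F'"
    using assms(1) by (rule C1_mapE) blast
  have "((\<lambda>x. q (F x)) has_derivative blinfun_apply (q' (F x) *\<^sub>R F' x)) (at x)" for x
    using has_derivative_compose[OF F'(1)[of x]
        has_field_derivative_imp_has_derivative[OF assms(2)[of "F x"]]]
    by (simp add: scaleR_blinfun.rep_eq)
  moreover have "continuous_on UNIV (\<lambda>x. q' (F x) *\<^sub>R F' x)"
    using F'(2) continuous_on_compose2[OF assms(3) C1_map_imp_continuous[OF assms(1)]]
    by (auto intro!: continuous_intros)
  ultimately show ?thesis
    unfolding C1_map_def by (intro exI[of _ "\<lambda>x. q' (F x) *\<^sub>R F' x"] conjI allI)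
qed

text \<open>The squared norm is smooth at the origin too, unlike the norm; radial cutoffs are
  therefore built from it.\<close>

lemma C1_map_norm_sqr: "C1_map (\<lambda>x::'a::real_inner. (norm x)\<^sup>2)"
  unfolding C1_map_def
proof (intro exI[of _ "\<lambda>x. 2 *\<^sub>R blinfun_inner_right x"] conjI allI)
  fix x :: 'a
  show "((\<lambda>x. (norm x)\<^sup>2) has_derivative blinfun_apply (2 *\<^sub>R blinfun_inner_right x)) (at x)"
    unfolding power2_norm_eq_inner
    by (auto intro!: derivative_eq_intros simp: scaleR_blinfun.rep_eq inner_commute)
qed (auto intro!: continuous_intros bounded_linear.continuous_on[OF bounded_linear_blinfun_inner_right])

section \<open>Product, sum and chain rules for partial derivatives\<close>

lemma partial_deriv_mult:
  fixes F G :: "real ^ 'n \<Rightarrow> real"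
  assumes "C1_map F" "C1_map G"
  shows "partial_deriv k (\<lambda>x. F x * G x) x = partial_deriv k F x * G x + F x * partial_deriv k G x"
  unfolding partial_deriv_def[of k "\<lambda>x. F x * G x"]
  using C1_map_DERIV_along_axis[OF assms(1), of x k 0] C1_map_DERIV_along_axis[OF assms(2), of x k 0]
  by (intro DERIV_imp_deriv) (auto intro!: derivative_eq_intros)

lemma partial_deriv_add:
  fixes F G :: "real ^ 'n \<Rightarrow> real"
  assumes "C1_map F" "C1_map G"
  shows "partial_deriv k (\<lambda>x. F x + G x) x = partial_deriv k F x + partial_deriv k G x"
  unfolding partial_deriv_def[of k "\<lambda>x. F x + G x"]
  using C1_map_DERIV_along_axis[OF assms(1), of x k 0] C1_map_DERIV_along_axis[OF assms(2), of x k 0]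
  by (intro DERIV_imp_deriv) (auto intro!: derivative_eq_intros)

lemma partial_deriv_diff:
  fixes F G :: "real ^ 'n \<Rightarrow> real"
  assumes "C1_map F" "C1_map G"
  shows "partial_deriv k (\<lambda>x. F x - G x) x = partial_deriv k F x - partial_deriv k G x"
  unfolding partial_deriv_def[of k "\<lambda>x. F x - G x"]
  using C1_map_DERIV_along_axis[OF assms(1), of x k 0] C1_map_DERIV_along_axis[OF assms(2), of x k 0]
  by (intro DERIV_imp_deriv) (auto intro!: derivative_eq_intros)

lemma partial_deriv_const: "partial_deriv k (\<lambda>x. c) x = 0"
  by (simp add: partial_deriv_def)

lemma partial_deriv_sum:
  fixes F :: "'i \<Rightarrow> real ^ 'n \<Rightarrow> real"
  assumes "\<And>i. i \<in> I \<Longrightarrow> C1_map (F i)"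
  shows "partial_deriv k (\<lambda>x. \<Sum>i\<in>I. F i x) x = (\<Sum>i\<in>I. partial_deriv k (F i) x)"
  using assms
  by (induction I rule: infinite_finite_induct)
    (auto simp: partial_deriv_const partial_deriv_add C1_map_sum)

lemma partial_deriv_compose_real:
  fixes F :: "real ^ 'n \<Rightarrow> real"
  assumes "C1_map F" "(q has_real_derivative q') (at (F x))"
  shows "partial_deriv k (\<lambda>x. q (F x)) x = q' * partial_deriv k F x"
  unfolding partial_deriv_def[of k "\<lambda>x. q (F x)"]
  using DERIV_chain2[of q q' "\<lambda>s. F (x + s *\<^sub>R axis k 1)" 0]
    C1_map_DERIV_along_axis[OF assms(1), of x k 0] assms(2)
  by (intro DERIV_imp_deriv) auto

lemma partial_deriv_norm_sqr: "partial_deriv k (\<lambda>x::real^'n. (norm x)\<^sup>2) x = 2 * x $ k"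
proof -
  have "((\<lambda>x::real^'n. (norm x)\<^sup>2) has_derivative (\<lambda>y. 2 * (x \<bullet> y))) (at x)"
    unfolding power2_norm_eq_inner by (auto intro!: derivative_eq_intros simp: inner_commute)
  from partial_deriv_eq[OF this] show ?thesis by (simp add: inner_axis)
qed

section \<open>Integration of derivatives of compactly supported functions\<close>

lemma integrable_continuous_compact_support:
  fixes f :: "'a::euclidean_space \<Rightarrow> real"
  assumes "continuous_on UNIV f" "\<And>x. R < norm x \<Longrightarrow> f x = 0"
  shows "integrable lborel f"
proof -
  have "integrable lborel (\<lambda>x. indicator (cball 0 R) x *\<^sub>R f x)"
    by (intro borel_integrable_compact compact_cball continuous_on_subset[OF assms(1)]) auto
  moreover have "(\<lambda>x. indicator (cball 0 R) x *\<^sub>R f x) = f"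
    using assms(2) by (auto simp: indicator_def fun_eq_iff)
  ultimately show ?thesis by simp
qed

lemma partial_deriv_eq_0_outside:
  fixes F :: "real ^ 'n \<Rightarrow> real"
  assumes "\<And>x. R < norm x \<Longrightarrow> F x = 0" "R < norm x"
  shows "partial_deriv k F x = 0"
proof -
  have "open {x::real^'n. R < norm x}" by (intro open_Collect_less continuous_intros)
  then have "(F has_derivative (\<lambda>_. 0)) (at x)"
    by (rule has_derivative_transform_within_open[OF has_derivative_const[of 0]])
      (use assms in auto)
  from partial_deriv_eq[OF this] show ?thesis .
qed

text \<open>The translates of \<open>F\<close> all have the same integral, so the integrals of its difference
  quotients vanish; they are dominated because \<open>F\<close> is Lipschitz with compact support.\<close>

lemma integral_partial_deriv_compact_support:
  fixes F :: "real ^ 'n \<Rightarrow> real"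
  assumes C1: "C1_map F" and supp: "\<And>x. R < norm x \<Longrightarrow> F x = 0"
  shows "integrable lborel (partial_deriv k F)" and "integral\<^sup>L lborel (partial_deriv k F) = 0"
proof -
  let ?e = "axis k (1::real)"
  let ?D = "partial_deriv k F"
  have cont: "continuous_on UNIV ?D" by (rule continuous_on_partial_deriv[OF C1])
  have supp': "?D x = 0" if "R < norm x" for x
    using partial_deriv_eq_0_outside[of R F x k] supp that by blast
  show int: "integrable lborel ?D"
    using cont supp' by (rule integrable_continuous_compact_support)
  have "bounded (?D ` cball 0 R)"
    by (intro compact_imp_bounded compact_continuous_image continuous_on_subset[OF cont]) auto
  then obtain M where "M > 0" and M: "\<And>x. norm x \<le> R \<Longrightarrow> \<bar>?D x\<bar> \<le> M"
    unfolding bounded_pos by (auto simp: image_iff)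
  have M: "\<bar>?D x\<bar> \<le> M" for x
    using M[of x] supp'[of x] \<open>M > 0\<close> by (cases "norm x \<le> R") auto
  \<comment> \<open>The mean value inequality along the line through \<open>x\<close> in direction
    \<open>?e\<close>.\<close>
  have lip: "\<bar>F (x + t *\<^sub>R ?e) - F x\<bar> \<le> M * \<bar>t\<bar>" for x t
    using field_differentiable_bound[of UNIV "\<lambda>s. F (x + s *\<^sub>R ?e)" "\<lambda>s. ?D (x + s *\<^sub>R ?e)" M t 0]
      C1_map_DERIV_along_axis[OF C1] M by auto
  \<comment> \<open>\<open>Suc i\<close> keeps the step nonzero, and \<open>t i\<close> being at
    most 1 puts the support of every difference quotient inside the ball of radius
    \<open>R + 1\<close>, where the constant \<open>M\<close> dominates.\<close>
  define t where "t i = inverse (real (Suc i))" for i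
  have t: "t i \<noteq> 0" "0 < t i" "t i \<le> 1" for i
    unfolding t_def by (auto simp: field_simps)
  define Q where "Q i x = (F (x + t i *\<^sub>R ?e) - F x) / t i" for i x
  have F_int: "integrable lborel F"
    using C1_map_imp_continuous[OF C1] supp by (rule integrable_continuous_compact_support)
  have F_meas [measurable]: "F \<in> borel_measurable borel"
    using borel_measurable_continuous_onI[OF C1_map_imp_continuous[OF C1]] .
  have shift: "has_bochner_integral lborel (\<lambda>x. F (x + c)) (integral\<^sup>L lborel F)" for c
  proof -
    have "has_bochner_integral (distr lborel borel ((+) c)) F (integral\<^sup>L lborel F)"
      using F_int by (simp add: lborel_distr_plus has_bochner_integral_integrable)
    then show ?thesis
      by (simp add: has_bochner_integral_iff integrable_distr_eq integral_distr add.commute)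
  qed
  have Q_int: "integral\<^sup>L lborel (Q i) = 0" for i
    unfolding Q_def using shift[of "t i *\<^sub>R ?e"] F_int by (simp add: has_bochner_integral_iff)
  have "(\<lambda>i. integral\<^sup>L lborel (Q i)) \<longlonglongrightarrow> integral\<^sup>L lborel ?D"
  proof (rule integral_dominated_convergence[where w = "\<lambda>x. indicator (cball 0 (R + 1)) x *\<^sub>R M"])
    show "?D \<in> borel_measurable lborel" using int by auto
    show "Q i \<in> borel_measurable lborel" for i unfolding Q_def by measurable
    show "integrable lborel (\<lambda>x::real^'n. indicator (cball 0 (R + 1)) x *\<^sub>R M)"
      by (intro borel_integrable_compact compact_cball continuous_intros)
    show "AE x in lborel. (\<lambda>i. Q i x) \<longlonglongrightarrow> ?D x"
    proof (rule AE_I2)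
      fix x
      have "((\<lambda>s. (F (x + s *\<^sub>R ?e) - F x) / s) \<longlongrightarrow> ?D x) (at 0)"
        using C1_map_DERIV_along_axis[OF C1, of x k 0] by (simp add: has_field_derivative_iff)
      moreover have "filterlim t (at 0) sequentially"
        unfolding filterlim_at using t(1) LIMSEQ_inverse_real_of_nat by (auto simp: t_def[abs_def])
      ultimately show "(\<lambda>i. Q i x) \<longlonglongrightarrow> ?D x"
        unfolding Q_def by (rule filterlim_compose)
    qed
    show "AE x in lborel. norm (Q i x) \<le> indicator (cball 0 (R + 1)) x *\<^sub>R M" for i
    proof (rule AE_I2)
      fix x
      show "norm (Q i x) \<le> indicator (cball 0 (R + 1)) x *\<^sub>R M"
      proof (cases "norm x \<le> R + 1")
        case True
        then show ?thesis using lip[of x "t i"] t[of i] by (simp add: Q_def field_simps)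
      next
        case False
        have "norm x \<le> norm (x + t i *\<^sub>R ?e) + norm (t i *\<^sub>R ?e)"
          using norm_triangle_ineq4[of "x + t i *\<^sub>R ?e" "t i *\<^sub>R ?e"] by simp
        then have "R < norm (x + t i *\<^sub>R ?e)" "R < norm x"
          using False t[of i] by simp_all
        then show ?thesis using False supp by (simp add: Q_def)
      qed
    qed
  qed
  then show "integral\<^sup>L lborel ?D = 0"
    by (simp add: Q_int LIMSEQ_const_iff)
qed

section \<open>Cutoff functions and the vanishing integral of a decaying divergence\<close>

lemma DERIV_pos_part_sqr: "((\<lambda>t::real. (max 0 t)\<^sup>2) has_real_derivative 2 * max 0 t) (at t)"
proof -
  consider "t < 0" | "t = 0" | "t > 0" by linarith
  then show ?thesis
  proof cases
    case 1
    have "((\<lambda>t. 0) has_real_derivative 0) (at t)" by simp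
    then have "((\<lambda>t. (max 0 t)\<^sup>2) has_real_derivative 0) (at t)"
      by (rule has_field_derivative_transform_within_open[of _ _ _ "{..<0}"]) (use 1 in auto)
    with 1 show ?thesis by simp
  next
    case 2
    have "isCont (\<lambda>t::real. max 0 t) 0" by (intro continuous_intros)
    then have "((\<lambda>t::real. max 0 t) \<longlongrightarrow> 0) (at 0)" by (simp add: isCont_def)
    \<comment> \<open>Away from 0 the difference quotient of the squared positive part is again
      \<open>max 0 t\<close>.\<close>
    then have "((\<lambda>t::real. ((max 0 t)\<^sup>2 - (max 0 0)\<^sup>2) / (t - 0)) \<longlongrightarrow> 0) (at 0)"
      by (rule Lim_transform_eventually)
        (auto simp: eventually_at_filter max_def power2_eq_square)
    with 2 show ?thesis by (simp add: has_field_derivative_iff)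
  next
    case 3
    have "((\<lambda>t. t\<^sup>2) has_real_derivative 2 * t) (at t)"
      by (auto intro!: derivative_eq_intros)
    then have "((\<lambda>t. (max 0 t)\<^sup>2) has_real_derivative 2 * t) (at t)"
      by (rule has_field_derivative_transform_within_open[of _ _ _ "{0<..}"]) (use 3 in auto)
    with 3 show ?thesis by simp
  qed
qed

text \<open>One derivative is enough for the cutoff argument, so an explicit piecewise polynomial
  serves. With \<open>q\<close> the squared positive part, \<open>q (1 - q (s - 1))\<close> is 1 as
  long as the inner \<open>q\<close> vanishes, and 0 once the inner \<open>q\<close> has reached
  1.\<close>

lemma smooth_step_exists:
  obtains \<eta> \<eta>' :: "real \<Rightarrow> real" where
    "\<And>s. (\<eta> has_real_derivative \<eta>' s) (at s)" "continuous_on UNIV \<eta>'"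
    "\<And>s. 0 \<le> \<eta> s" "\<And>s. \<eta> s \<le> 1"
    "\<And>s. s \<le> 1 \<Longrightarrow> \<eta> s = 1" "\<And>s. 2 \<le> s \<Longrightarrow> \<eta> s = 0"
    "\<And>s. \<bar>\<eta>' s\<bar> \<le> 4" "\<And>s. s \<le> 1 \<Longrightarrow> \<eta>' s = 0" "\<And>s. 2 \<le> s \<Longrightarrow> \<eta>' s = 0"
proof
  define q :: "real \<Rightarrow> real" where "q t = (max 0 t)\<^sup>2" for t
  define \<eta> where "\<eta> s = q (1 - q (s - 1))" for s
  define \<eta>' where "\<eta>' s = - (2 * max 0 (1 - q (s - 1)) * (2 * max 0 (s - 1)))" for s
  have q_big: "1 \<le> q (s - 1)" if "2 \<le> s" for s
    using that by (simp add: q_def)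
  have q_nonneg: "0 \<le> q s" for s by (simp add: q_def)
  have q_le: "q s \<le> 1" if "s \<le> 1" for s
    using that power_le_one[of "max 0 s" 2] by (simp add: q_def)
  have DERIV_q: "(q has_real_derivative 2 * max 0 s) (at s)" for s
    unfolding q_def[abs_def] by (rule DERIV_pos_part_sqr)
  show "(\<eta> has_real_derivative \<eta>' s) (at s)" for s
  proof -
    have "((\<lambda>s. s - 1) has_real_derivative 1) (at s)"
      by (auto intro!: derivative_eq_intros)
    from DERIV_chain2[OF DERIV_q this]
    have "((\<lambda>s. 1 - q (s - 1)) has_real_derivative - (2 * max 0 (s - 1))) (at s)"
      by (auto intro!: derivative_eq_intros)
    from DERIV_chain2[OF DERIV_q this] show ?thesis
      unfolding \<eta>_def[abs_def] \<eta>'_def by simp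
  qed
  show "continuous_on UNIV \<eta>'"
    unfolding \<eta>'_def[abs_def] q_def by (intro continuous_intros)
  show "0 \<le> \<eta> s" "\<eta> s \<le> 1" for s
    using q_nonneg q_le[of "1 - q (s - 1)"] by (simp_all add: \<eta>_def)
  show "\<eta> s = 1" "\<eta>' s = 0" if "s \<le> 1" for s
    using that by (simp_all add: \<eta>_def \<eta>'_def q_def)
  show "\<eta> s = 0" and zero: "\<eta>' s = 0" if "2 \<le> s" for s
    using q_big[OF that] by (simp_all add: \<eta>_def \<eta>'_def q_def[of "1 - q _"])
  show "\<bar>\<eta>' s\<bar> \<le> 4" for s
  proof (cases "s \<le> 2")
    case True
    \<comment> \<open>The 4 is the product of the two factors 2 from differentiating
      \<open>q\<close> twice in the chain; both positive parts are at most 1 for \<open>s\<close> up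
      to 2.\<close>
    have "max 0 (1 - q (s - 1)) * max 0 (s - 1) \<le> 1 * 1"
      using True q_nonneg[of "s - 1"] by (intro mult_mono) auto
    then show ?thesis by (simp add: \<eta>'_def abs_mult)
  next
    case False
    then show ?thesis using zero[of s] by simp
  qed
qed

text \<open>The cutoff gradient is of size \<open>1 / R\<close> and lives on the annulus \<open>R \<le> |x| \<le> 2 R\<close>, of volume
  at most a constant times \<open>R ^ n\<close>; this is exactly balanced by the decay of \<open>W\<close>.\<close>

lemma integral_cutoff_vec_div_bound:
  fixes W :: "real ^ 'n \<Rightarrow> real ^ 'n"
  assumes C1: "\<And>k. C1_map (\<lambda>x. W x $ k)"
    and int: "integrable lborel (vec_div W)"
    and "R > 0" "\<epsilon> \<ge> 0"
    and W: "\<And>x. R \<le> norm x \<Longrightarrow> norm (W x) \<le> \<epsilon> * norm x powr (1 - real CARD('n))"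
    and \<eta>: "\<And>s. (\<eta> has_real_derivative \<eta>' s) (at s)" "continuous_on UNIV \<eta>'"
      "\<And>s. 0 \<le> \<eta> s" "\<And>s. \<eta> s \<le> 1"
      "\<And>s. 2 \<le> s \<Longrightarrow> \<eta> s = 0"
      "\<And>s. \<bar>\<eta>' s\<bar> \<le> 4" "\<And>s. s \<le> 1 \<Longrightarrow> \<eta>' s = 0" "\<And>s. 2 \<le> s \<Longrightarrow> \<eta>' s = 0"
  shows "\<bar>\<integral>x. \<eta> ((norm x)\<^sup>2 / R\<^sup>2) * vec_div W x \<partial>lborel\<bar>
    \<le> \<epsilon> * (16 * 2 ^ CARD('n) * unit_ball_vol (real CARD('n)))"
proof -
  define \<theta> where "\<theta> x = \<eta> ((norm x)\<^sup>2 / R\<^sup>2)" for x :: "real ^ 'n"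
  have DERIV_scaled: "((\<lambda>s. \<eta> (s / R\<^sup>2)) has_real_derivative \<eta>' (s / R\<^sup>2) / R\<^sup>2) (at s)" for s
  proof -
    have "((\<lambda>s. s / R\<^sup>2) has_real_derivative 1 / R\<^sup>2) (at s)"
      by (rule DERIV_cdivide[OF DERIV_ident])
    from DERIV_chain2[OF \<eta>(1) this] show ?thesis by simp
  qed
  have \<theta>_C1: "C1_map \<theta>"
    unfolding \<theta>_def[abs_def]
    by (rule C1_map_compose_real[OF C1_map_norm_sqr DERIV_scaled])
      (use \<open>R > 0\<close> in \<open>auto intro!: continuous_intros continuous_on_compose2[OF \<eta>(2)]\<close>)
  have partial_\<theta>: "partial_deriv k \<theta> x = \<eta>' ((norm x)\<^sup>2 / R\<^sup>2) / R\<^sup>2 * (2 * x $ k)" for k x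
    unfolding \<theta>_def[abs_def]
    by (simp only: partial_deriv_compose_real[OF C1_map_norm_sqr DERIV_scaled] partial_deriv_norm_sqr)
  \<comment> \<open>The cutoff vanishes already from radius sqrt 2 times \<open>R\<close> on; the
    cruder radius \<open>2 * R\<close> avoids square roots.\<close>
  have big: "2 \<le> (norm x)\<^sup>2 / R\<^sup>2" if "2 * R < norm x" for x :: "real ^ 'n"
  proof -
    have "(2 * R)\<^sup>2 \<le> (norm x)\<^sup>2" using that \<open>R > 0\<close> by (intro power_mono) auto
    then have "2 * R\<^sup>2 \<le> (norm x)\<^sup>2"
      by (simp add: power_mult_distrib) (use zero_le_power2[of R] in linarith)
    then show ?thesis using \<open>R > 0\<close> by (simp add: le_divide_eq)
  qed
  have small: "(norm x)\<^sup>2 / R\<^sup>2 \<le> 1" if "norm x \<le> R" for x :: "real ^ 'n"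
    using power_mono[OF that norm_ge_zero, of 2] \<open>R > 0\<close> by (simp add: divide_le_eq)
  \<comment> \<open>Product rule for the divergence of \<open>\<theta>\<close> times
    \<open>W\<close>: \<open>S\<close> is the whole, \<open>T\<close> the cutoff times the
    divergence, \<open>U\<close> the gradient of the cutoff against \<open>W\<close>. Since
    \<open>S\<close> integrates to 0, bounding the integral of \<open>U\<close> bounds that of
    \<open>T\<close>.\<close>
  define S where "S x = (\<Sum>k\<in>UNIV. partial_deriv k (\<lambda>y. \<theta> y * W y $ k) x)" for x
  define T where "T x = \<theta> x * vec_div W x" for x
  define U where "U x = \<eta>' ((norm x)\<^sup>2 / R\<^sup>2) * 2 / R\<^sup>2 * (x \<bullet> W x)" for x
  have "\<theta> x * W x $ k = 0" if "2 * R < norm x" for x k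
    using \<eta>(5)[OF big[OF that]] by (simp add: \<theta>_def)
  note parts = integral_partial_deriv_compact_support[OF C1_map_mult[OF \<theta>_C1 C1] this]
  have S: "integrable lborel S" "integral\<^sup>L lborel S = 0"
    unfolding S_def[abs_def] using parts by (simp_all add: Bochner_Integration.integral_sum)
  have \<theta>_meas [measurable]: "\<theta> \<in> borel_measurable borel"
    using borel_measurable_continuous_onI[OF C1_map_imp_continuous[OF \<theta>_C1]] .
  have T: "integrable lborel T"
  proof (rule Bochner_Integration.integrable_bound[OF int])
    show "T \<in> borel_measurable lborel"
      unfolding T_def using int by measurable
    have "\<bar>\<theta> x\<bar> \<le> 1" for x using \<eta>(3,4) by (simp add: \<theta>_def)
    then show "AE x in lborel. norm (T x) \<le> norm (vec_div W x)"
      by (auto simp: T_def abs_mult intro!: mult_left_le_one_le)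
  qed
  have "U x = S x - T x" for x
  proof -
    have "S x = (\<Sum>k\<in>UNIV. \<eta>' ((norm x)\<^sup>2 / R\<^sup>2) * 2 / R\<^sup>2 * (x $ k * W x $ k)
        + \<theta> x * partial_deriv k (\<lambda>y. W y $ k) x)"
      unfolding S_def by (intro sum.cong refl) (simp add: partial_deriv_mult[OF \<theta>_C1 C1] partial_\<theta>)
    then show ?thesis
      by (simp add: U_def T_def vec_div_def sum.distrib sum_distrib_left inner_vec_def)
  qed
  then have U_eq: "U = (\<lambda>x. S x - T x)" by blast
  then have U: "integrable lborel U" using S T by simp
  \<comment> \<open>Bound for \<open>U\<close> on the annulus: 4 for the profile derivative,
    \<open>2 / R^2\<close> from the chain rule, \<open>2 * R\<close> for \<open>norm x\<close>, and
    the decay of \<open>W\<close> at radius \<open>R\<close>.\<close>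
  define K where "K = 16 * \<epsilon> / R * R powr (1 - real CARD('n))"
  have "K \<ge> 0" using \<open>R > 0\<close> \<open>\<epsilon> \<ge> 0\<close> by (simp add: K_def)
  have U_bound: "\<bar>U x\<bar> \<le> indicator (cball 0 (2 * R)) x *\<^sub>R K" for x
  proof -
    consider "norm x \<le> R" | "2 * R < norm x" | "R \<le> norm x" "norm x \<le> 2 * R" by linarith
    then show ?thesis
    proof cases
      case 1
      then show ?thesis using \<eta>(7)[OF small[OF 1]] \<open>K \<ge> 0\<close> by (simp add: U_def)
    next
      case 2
      then show ?thesis using \<eta>(8)[OF big[OF 2]] \<open>K \<ge> 0\<close> by (simp add: U_def)
    next
      case 3
      \<comment> \<open>The exponent is not positive, so the power is largest at the inner
        radius.\<close>
      have "norm x powr (1 - real CARD('n)) \<le> R powr (1 - real CARD('n))"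
        using 3 \<open>R > 0\<close> by (intro powr_mono2') auto
      then have "norm (W x) \<le> \<epsilon> * R powr (1 - real CARD('n))"
        using W[OF 3(1)] \<open>\<epsilon> \<ge> 0\<close> by (meson mult_left_mono order_trans)
      then have "\<bar>x \<bullet> W x\<bar> \<le> (2 * R) * (\<epsilon> * R powr (1 - real CARD('n)))"
        using 3 \<open>R > 0\<close> by (intro order_trans[OF Cauchy_Schwarz_ineq2] mult_mono) auto
      moreover have "\<bar>\<eta>' ((norm x)\<^sup>2 / R\<^sup>2) * 2 / R\<^sup>2\<bar> \<le> 4 * 2 / R\<^sup>2"
        using \<eta>(6) by (auto simp: abs_mult intro!: divide_right_mono)
      ultimately have "\<bar>U x\<bar> \<le> 4 * 2 / R\<^sup>2 * ((2 * R) * (\<epsilon> * R powr (1 - real CARD('n))))"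
        unfolding U_def abs_mult[of "_ / _"] by (intro mult_mono) auto
      also have "\<dots> = K" using \<open>R > 0\<close> by (simp add: K_def field_simps power2_eq_square)
      finally show ?thesis using 3 by simp
    qed
  qed
  have "integral\<^sup>L lborel U = - integral\<^sup>L lborel T"
    unfolding U_eq using S T by simp
  then have "\<bar>integral\<^sup>L lborel T\<bar> = \<bar>integral\<^sup>L lborel U\<bar>" by simp
  also have "\<dots> \<le> (\<integral>x. indicator (cball 0 (2 * R)) (x::real^'n) *\<^sub>R K \<partial>lborel)"
  proof (rule integral_abs_bound_integral[OF U])
    show "integrable lborel (\<lambda>x::real^'n. indicator (cball 0 (2 * R)) x *\<^sub>R K)"
      by (intro borel_integrable_compact compact_cball continuous_intros)
  qed (use U_bound in auto)
  also have "\<dots> = K * (unit_ball_vol (real CARD('n)) * (2 * R) ^ CARD('n))"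
    using content_cball[of "2 * R" "0::real^'n"] \<open>R > 0\<close> by simp
  \<comment> \<open>The factor \<open>R ^ CARD('n)\<close> of the ball volume cancels the powers of
    \<open>R\<close> in \<open>K\<close>, leaving a bound independent of \<open>R\<close>.\<close>
  also have "\<dots> = \<epsilon> * (16 * 2 ^ CARD('n) * unit_ball_vol (real CARD('n)))"
  proof -
    have "R powr (1 - real CARD('n)) * R ^ CARD('n) = R"
      using \<open>R > 0\<close> by (simp add: powr_diff powr_realpow)
    then show ?thesis using \<open>R > 0\<close> by (simp add: K_def power_mult_distrib field_simps)
  qed
  finally show ?thesis by (simp add: T_def[abs_def] \<theta>_def)
qed

text \<open>As the radius grows, the cutoff integrals converge to the full integral by dominated
  convergence. They also tend to 0: the decay constant can be taken arbitrarily small for large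
  radii, and its multiplier in the cutoff bound does not depend on the radius.\<close>

lemma integral_vec_div_eq_0:
  fixes W :: "real ^ 'n \<Rightarrow> real ^ 'n"
  assumes C1: "\<And>k. C1_map (\<lambda>x. W x $ k)"
    and int: "integrable lborel (vec_div W)"
    and decay: "(\<lambda>x. norm (W x)) \<in> o[at_infinity](\<lambda>x. norm x powr (1 - real CARD('n)))"
  shows "integral\<^sup>L lborel (vec_div W) = 0"
proof -
  obtain \<eta> \<eta>' :: "real \<Rightarrow> real" where
    \<eta>: "\<And>s. (\<eta> has_real_derivative \<eta>' s) (at s)" "continuous_on UNIV \<eta>'"
      "\<And>s. 0 \<le> \<eta> s" "\<And>s. \<eta> s \<le> 1" "\<And>s. 2 \<le> s \<Longrightarrow> \<eta> s = 0"
      "\<And>s. \<bar>\<eta>' s\<bar> \<le> 4" "\<And>s. s \<le> 1 \<Longrightarrow> \<eta>' s = 0" "\<And>s. 2 \<le> s \<Longrightarrow> \<eta>' s = 0"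
    and \<eta>_one: "\<And>s. s \<le> 1 \<Longrightarrow> \<eta> s = 1"
    by (rule smooth_step_exists) blast
  define T where "T i x = \<eta> ((norm x)\<^sup>2 / (real (Suc i))\<^sup>2) * vec_div W x" for i x
  have "continuous_on UNIV \<eta>"
    by (meson DERIV_isCont \<eta>(1) continuous_at_imp_continuous_on)
  then have [measurable]: "\<eta> \<in> borel_measurable borel"
    by (rule borel_measurable_continuous_onI)
  have [measurable]: "vec_div W \<in> borel_measurable borel" using int by auto
  have "(\<lambda>i. integral\<^sup>L lborel (T i)) \<longlonglongrightarrow> integral\<^sup>L lborel (vec_div W)"
  proof (rule integral_dominated_convergence[where w = "\<lambda>x. norm (vec_div W x)"])
    show "T i \<in> borel_measurable lborel" for i
      unfolding T_def by measurable
    show "AE x in lborel. (\<lambda>i. T i x) \<longlonglongrightarrow> vec_div W x"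
    proof (rule AE_I2)
      fix x :: "real ^ 'n"
      \<comment> \<open>At a fixed point the cutoff is 1 as soon as the radius \<open>Suc i\<close>
        reaches \<open>norm x\<close>, so the sequence is eventually constant.\<close>
      have "T i x = vec_div W x" if "nat \<lceil>norm x\<rceil> \<le> i" for i
      proof -
        have "norm x \<le> real (Suc i)" using that by linarith
        then have "(norm x)\<^sup>2 / (real (Suc i))\<^sup>2 \<le> 1"
          using power_mono[of "norm x" "real (Suc i)" 2] by (simp add: divide_le_eq del: of_nat_Suc)
        then show ?thesis using \<eta>_one by (simp add: T_def)
      qed
      then show "(\<lambda>i. T i x) \<longlonglongrightarrow> vec_div W x"
        by (intro tendsto_eventually eventually_sequentiallyI)
    qed
    show "AE x in lborel. norm (T i x) \<le> norm (vec_div W x)" for i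
      using \<eta>(3,4) by (auto simp: T_def abs_mult intro!: mult_left_le_one_le)
  qed (use int in auto)
  moreover have "(\<lambda>i. integral\<^sup>L lborel (T i)) \<longlonglongrightarrow> 0"
  proof (rule LIMSEQ_I)
    fix e :: real assume "e > 0"
    define C where "C = 16 * 2 ^ CARD('n) * unit_ball_vol (real CARD('n))"
    have "C > 0" by (simp add: C_def)
    \<comment> \<open>Half of \<open>e / C\<close>, so that the final bound
      \<open>\<epsilon> * C\<close> is strictly below \<open>e\<close>.\<close>
    define \<epsilon> where "\<epsilon> = e / (2 * C)"
    have "\<epsilon> > 0" using \<open>e > 0\<close> \<open>C > 0\<close> by (simp add: \<epsilon>_def)
    obtain b where b: "\<And>x. b \<le> norm x \<Longrightarrow> norm (W x) \<le> \<epsilon> * norm x powr (1 - real CARD('n))"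
      using landau_o.smallD[OF decay \<open>\<epsilon> > 0\<close>] unfolding eventually_at_infinity by auto
    have "norm (integral\<^sup>L lborel (T i) - 0) < e" if "nat \<lceil>b\<rceil> \<le> i" for i
    proof -
      have "b \<le> real (Suc i)" using that by linarith
      then have "\<bar>integral\<^sup>L lborel (T i)\<bar> \<le> \<epsilon> * C"
        unfolding T_def C_def
        by (intro integral_cutoff_vec_div_bound[OF C1 int _ _ _ \<eta>]) (use b \<open>\<epsilon> > 0\<close> in auto)
      also have "\<dots> < e" using \<open>C > 0\<close> \<open>e > 0\<close> by (simp add: \<epsilon>_def)
      finally show ?thesis by simp
    qed
    then show "\<exists>N. \<forall>i\<ge>N. norm (integral\<^sup>L lborel (T i) - 0) < e" by blast
  qed
  ultimately show ?thesis by (rule LIMSEQ_unique)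
qed

section \<open>The probability flux of a pair and its divergence\<close>

definition flux_density ::
    "(real ^ 'n \<Rightarrow> real ^ 'n) \<Rightarrow> (real ^ 'n \<Rightarrow> real ^ 'n ^ 'n) \<Rightarrow>
     (real ^ 'n \<Rightarrow> real) \<Rightarrow> (real ^ 'n \<Rightarrow> real) \<Rightarrow> real ^ 'n \<Rightarrow> real ^ 'n" where
  "flux_density \<phi> G u v x = (u x * v x) *\<^sub>R (\<phi> x - (1/2) *\<^sub>R mat_div G x)
     + (1/2) *\<^sub>R (G x *v (u x *\<^sub>R gradient v x - v x *\<^sub>R gradient u x))"

lemma generator_eq_sum:
  "generator b G \<phi> x = (\<Sum>j\<in>UNIV. b x $ j * partial_deriv j \<phi> x
     + 1/2 * (\<Sum>k\<in>UNIV. G x $ j $ k * partial_deriv j (partial_deriv k \<phi>) x))"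
proof -
  have "frob_inner (G x) (hessian \<phi> x)
      = (\<Sum>j\<in>UNIV. \<Sum>k\<in>UNIV. G x $ j $ k * partial_deriv j (partial_deriv k \<phi>) x)"
    unfolding frob_inner_def trace_def matrix_matrix_mult_def transpose_def hessian_def
    by (subst sum.swap) simp
  then show ?thesis
    by (simp add: generator_def inner_vec_def gradient_def sum.distrib sum_distrib_left)
qed

context
  fixes \<phi> :: "real ^ 'n \<Rightarrow> real ^ 'n" and G :: "real ^ 'n \<Rightarrow> real ^ 'n ^ 'n"
    and u v :: "real ^ 'n \<Rightarrow> real"
  assumes \<phi>: "C1_map \<phi>" and G: "C2_map G" and G_sym: "\<And>x. transpose (G x) = G x"
    and u: "C2_map u" and v: "C2_map v"
begin

text \<open>Apart from the drift term, the \<open>j\<close>-th component of the flux is half the sum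
  over \<open>k\<close> of these entries. Splitting by index pairs prepares the antisymmetry
  argument.\<close>

private definition flux_part :: "'n \<Rightarrow> 'n \<Rightarrow> real ^ 'n \<Rightarrow> real" where
  "flux_part j k x = G x $ j $ k * (u x * partial_deriv k v x) - G x $ j $ k * (v x * partial_deriv k u x)
     - u x * (v x * partial_deriv k (\<lambda>y. G y $ j $ k) x)"

private lemma G_C2: "C2_map (\<lambda>x. G x $ j $ k)"
  by (intro C2_map_component G)

private lemmas C1s = C2_map_imp_C1_map[OF u] C2_map_imp_C1_map[OF v] C2_map_imp_C1_map[OF G_C2]
  C1_map_partial_deriv[OF u] C1_map_partial_deriv[OF v] C1_map_partial_deriv[OF G_C2]
  C1_map_component[OF \<phi>]

private lemma flux_part_C1: "C1_map (flux_part j k)"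
  unfolding flux_part_def[abs_def] by (intro C1_map_diff C1_map_mult C1s)

private lemma flux_density_component:
  "flux_density \<phi> G u v x $ j = u x * (v x * \<phi> x $ j) + 1/2 * (\<Sum>k\<in>UNIV. flux_part j k x)"
  unfolding flux_density_def flux_part_def mat_div_def matrix_vector_mult_def gradient_def
  by (simp add: algebra_simps sum.distrib sum_subtractf sum_distrib_left)

lemma C1_map_flux_density: "C1_map (\<lambda>x. flux_density \<phi> G u v x $ j)"
  unfolding flux_density_component
  by (intro C1_map_add C1_map_mult C1_map_const C1_map_sum flux_part_C1 C1s)

text \<open>The drift contribution is kept in two pieces: the first belongs to
  \<open>generator\<close> applied to \<open>v\<close>, the second to the divergence inside
  \<open>adjoint_generator\<close> applied to \<open>u\<close>.\<close>

private lemma partial_deriv_flux_density: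
  "partial_deriv j (\<lambda>x. flux_density \<phi> G u v x $ j) x
    = u x * \<phi> x $ j * partial_deriv j v x + v x * partial_deriv j (\<lambda>x. u x * \<phi> x $ j) x
      + 1/2 * (\<Sum>k\<in>UNIV. partial_deriv j (flux_part j k) x)"
  unfolding flux_density_component
  by (simp only: partial_deriv_add partial_deriv_mult partial_deriv_const partial_deriv_sum
      C1_map_add C1_map_mult C1_map_const C1_map_sum flux_part_C1 C1s) (simp add: algebra_simps)

text \<open>The first two terms carry second derivatives in the order used by \<open>hessian\<close>
  and \<open>mat_div2\<close>. In the remainder the symmetry of \<open>G\<close> allows
  \<open>G x $ k $ j\<close> in the subtracted half, which makes it that of the first half with
  \<open>j\<close> and \<open>k\<close> exchanged.\<close>

private lemma partial_deriv_flux_part: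
  "partial_deriv j (flux_part j k) x
    = u x * (G x $ j $ k * partial_deriv j (partial_deriv k v) x)
      - v x * partial_deriv j (partial_deriv k (\<lambda>y. u y * G y $ j $ k)) x
      + ((u x * partial_deriv j (\<lambda>y. G y $ j $ k) x + G x $ j $ k * partial_deriv j u x)
          * partial_deriv k v x
        - (u x * partial_deriv k (\<lambda>y. G y $ k $ j) x + G x $ k $ j * partial_deriv k u x)
          * partial_deriv j v x)"
proof -
  have sym: "G y $ k $ j = G y $ j $ k" for y
    using arg_cong[OF G_sym[of y], of "\<lambda>A. A $ j $ k"] by (simp add: transpose_def)
  have "partial_deriv k (\<lambda>y. u y * G y $ j $ k)
      = (\<lambda>y. partial_deriv k u y * G y $ j $ k + u y * partial_deriv k (\<lambda>y. G y $ j $ k) y)"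
    by (rule ext) (rule partial_deriv_mult[OF C1s(1,3)])
  then show ?thesis
    unfolding flux_part_def[abs_def] sym
    by (simp add: partial_deriv_add partial_deriv_diff partial_deriv_mult
        C1_map_add C1_map_diff C1_map_mult C1s algebra_simps)
qed

text \<open>The terms that are not accounted for by the two generators form an antisymmetric matrix in
  \<open>(j, k)\<close>, because \<open>G\<close> is symmetric.\<close>

lemma vec_div_flux_density:
  "vec_div (flux_density \<phi> G u v) x
    = u x * generator \<phi> G v x - v x * adjoint_generator \<phi> G u x"
proof -
  define A where "A j k = (u x * partial_deriv j (\<lambda>y. G y $ j $ k) x
    + G x $ j $ k * partial_deriv j u x) * partial_deriv k v x" for j k
  have "(\<Sum>j\<in>UNIV. \<Sum>k\<in>UNIV. A j k - A k j) = 0"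
    by (simp add: sum_subtractf) (subst sum.swap, simp)
  moreover have "vec_div (flux_density \<phi> G u v) x
      = u x * generator \<phi> G v x - v x * adjoint_generator \<phi> G u x
        + 1/2 * (\<Sum>j\<in>UNIV. \<Sum>k\<in>UNIV. A j k - A k j)"
    unfolding vec_div_def[of "flux_density \<phi> G u v"] partial_deriv_flux_density partial_deriv_flux_part
    unfolding A_def[symmetric] generator_eq_sum adjoint_generator_def mat_div2_def vec_div_def
    by (simp add: sum.distrib sum_subtractf sum_distrib_left algebra_simps)
  ultimately show ?thesis by simp
qed

end

section \<open>The generator under exponentiation and under a change of drift\<close>

lemma generator_exp:
  fixes l :: "real ^ 'n \<Rightarrow> real"
  assumes l: "C2_map l"
  shows "generator b G (\<lambda>x. exp (l x)) x
    = exp (l x) * (generator b G l x + 1/2 * (gradient l x \<bullet> (G x *v gradient l x)))"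
proof -
  note C1 = C2_map_imp_C1_map[OF l]
  have exp_C1: "C1_map (\<lambda>x. exp (l x))"
    by (rule C1_map_compose_real[OF C1 DERIV_exp]) (intro continuous_intros)
  have d1: "partial_deriv k (\<lambda>x. exp (l x)) = (\<lambda>x. exp (l x) * partial_deriv k l x)" for k
    by (rule ext) (rule partial_deriv_compose_real[OF C1 DERIV_exp])
  \<comment> \<open>Differentiating the exponential factor again produces the product of first
    derivatives; contracted with \<open>G\<close> it becomes the quadratic gradient term.\<close>
  have d2: "partial_deriv j (partial_deriv k (\<lambda>x. exp (l x))) x
      = exp (l x) * (partial_deriv j l x * partial_deriv k l x + partial_deriv j (partial_deriv k l) x)"
    for j k
    unfolding d1 by (simp add: partial_deriv_mult[OF exp_C1 C1_map_partial_deriv[OF l]] d1 algebra_simps)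
  show ?thesis
    unfolding generator_eq_sum d2
    by (simp add: d1 inner_vec_def matrix_vector_mult_def gradient_def sum.distrib
        sum_distrib_left algebra_simps)
qed

text \<open>Only the first-order part sees the drift. Moving \<open>g\<close> across the inner
  product turns the extra term into \<open>h\<close> against \<open>psi\<close> when the function is
  the logarithm of the density ratio.\<close>

lemma generator_add_drift:
  fixes g :: "real ^ 'n \<Rightarrow> real ^ 'm ^ 'n"
  shows "generator (\<lambda>x. f x + g x *v h x) G \<phi> x
    = generator f G \<phi> x + h x \<bullet> (transpose (g x) *v gradient \<phi> x)"
proof -
  have "(g x *v h x) \<bullet> y = h x \<bullet> (transpose (g x) *v y)" for y
    by (metis dot_lmul_matrix inner_commute transpose_matrix_vector)
  then show ?thesis by (simp add: generator_def inner_add_left)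
qed

text \<open>Identifies the quadratic gradient term for the diffusion matrix with the squared norm of
  \<open>psi\<close>.\<close>

lemma inner_matrix_mult_transpose:
  fixes g :: "real ^ 'm ^ 'n"
  shows "y \<bullet> ((g ** transpose g) *v y) = (norm (transpose g *v y))\<^sup>2"
proof -
  have "y \<bullet> (g *v (transpose g *v y)) = (transpose g *v y) \<bullet> (transpose g *v y)"
    by (simp add: transpose_matrix_vector flip: dot_lmul_matrix)
  then show ?thesis
    by (simp add: power2_norm_eq_inner flip: matrix_vector_mul_assoc)
qed

theorem lemma2:
  fixes f fh :: "real ^ 'n \<Rightarrow> real ^ 'n"
    and g :: "real ^ 'n \<Rightarrow> real ^ 'm ^ 'n"
    and h psi :: "real ^ 'n \<Rightarrow> real ^ 'm"
    and D :: "real ^ 'n \<Rightarrow> real ^ 'n ^ 'n"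
    and p p0 r :: "real ^ 'n \<Rightarrow> real"
  assumes fh_eq: "fh = (\<lambda>x. f x + g x *v h x)"
    and D_eq: "D = (\<lambda>x. g x ** transpose (g x))"
    and r_eq: "r = (\<lambda>x. p x / p0 x)"
    and psi_eq: "psi = (\<lambda>x. transpose (g x) *v gradient (\<lambda>y. ln (r y)) x)"
    and smooth: "C1_map f" "C2_map g" "C1_map h"
    and lipschitz: "lipschitz_map f" "lipschitz_map g" "lipschitz_map h" "lipschitz_map fh"
    and p_inv: "invariant_pdf fh D p" "\<And>q. invariant_pdf fh D q \<Longrightarrow> q = p" "\<And>x. p x > 0"
    and p0_inv: "invariant_pdf f D p0" "\<And>q. invariant_pdf f D q \<Longrightarrow> q = p0" "\<And>x. p0 x > 0"
    and moments:
      "mean_finite p (\<lambda>x. \<bar>generator fh D (\<lambda>y. ln (r y)) x\<bar>)"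
      "mean_finite p (\<lambda>x. (norm (h x))\<^sup>2)"
      "mean_finite p (\<lambda>x. (norm (psi x))\<^sup>2)"
    and decay:
      "decaying_pair fh D p (\<lambda>x. ln (r x))"
      "decaying_pair f D p0 r"
  shows "mean_finite p (\<lambda>x. h x \<bullet> psi x - 1/2 * (norm (psi x))\<^sup>2) \<and>
         mean p (\<lambda>x. h x \<bullet> psi x - 1/2 * (norm (psi x))\<^sup>2) = 0"
proof -
  define l where "l x = ln (r x)" for x
  define \<xi> where "\<xi> x = h x \<bullet> psi x - 1/2 * (norm (psi x))\<^sup>2" for x
  have r_pos: "r x > 0" for x using p_inv(3) p0_inv(3) by (simp add: r_eq)
  have p_eq: "p x = p0 x * r x" for x using p0_inv(3)[of x] by (simp add: r_eq)
  have r_exp: "r = (\<lambda>x. exp (l x))" using r_pos by (simp add: l_def)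
  \<comment> \<open>\<open>decaying_pair\<close> includes the regularity of its four arguments and
    the symmetry of the matrix field.\<close>
  have C: "C1_map fh" "C1_map f" "C2_map D" "\<And>x. transpose (D x) = D x" "C2_map p" "C2_map p0"
    "C2_map l" "C2_map r"
    using decay by (auto simp: decaying_pair_def l_def[abs_def])
  define W where "W = flux_density fh D p l"
  define W0 where "W0 = flux_density f D p0 r"
  have W_C1: "C1_map (\<lambda>x. W x $ k)" "C1_map (\<lambda>x. W0 x $ k)" for k
    unfolding W_def W0_def by (intro C1_map_flux_density C)+
  \<comment> \<open>\<open>flux_density\<close> repeats the field in \<open>decaying_pair\<close>
    term for term, so the decay follows by unfolding.\<close>
  have W_decay: "(\<lambda>x. norm (W x)) \<in> o[at_infinity](\<lambda>x. norm x powr (1 - real CARD('n)))"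
    "(\<lambda>x. norm (W0 x)) \<in> o[at_infinity](\<lambda>x. norm x powr (1 - real CARD('n)))"
    using decay by (simp_all add: decaying_pair_def W_def W0_def flux_density_def l_def[abs_def])
  \<comment> \<open>Stationarity of \<open>p\<close> under the drift \<open>fh\<close> removes the
    adjoint term; the same happens below for \<open>p0\<close> and \<open>f\<close>.\<close>
  have div_W: "vec_div W x = p x * generator fh D l x" for x
    unfolding W_def vec_div_flux_density[OF C(1,3,4,5,7)]
    using p_inv(1) by (simp add: invariant_pdf_def)
  have div_W0: "vec_div W0 x = p0 x * generator f D r x" for x
    unfolding W0_def vec_div_flux_density[OF C(2,3,4,6,8)]
    using p0_inv(1) by (simp add: invariant_pdf_def)
  have psi: "psi x = transpose (g x) *v gradient l x" for x
    by (simp add: psi_eq l_def[abs_def])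
  have gen_fh: "generator fh D l x = generator f D l x + h x \<bullet> psi x" for x
    unfolding fh_eq generator_add_drift psi ..
  have gen_r: "generator f D r x = r x * (generator f D l x + 1/2 * (norm (psi x))\<^sup>2)" for x
  proof -
    have "gradient l x \<bullet> (D x *v gradient l x) = (norm (psi x))\<^sup>2"
      unfolding D_eq psi by (rule inner_matrix_mult_transpose)
    then show ?thesis using generator_exp[OF C(7), of f D x] by (simp add: r_exp)
  qed
  \<comment> \<open>Because \<open>p\<close> equals \<open>p0\<close> times \<open>r\<close>, the
    two occurrences of \<open>generator f D l\<close> cancel in the difference.\<close>
  have \<xi>_p: "\<xi> x * p x = vec_div W x - vec_div W0 x" for x
    unfolding div_W div_W0 gen_fh gen_r p_eq \<xi>_def by (simp add: algebra_simps)
  \<comment> \<open>The first moment controls only the absolute value of the divergence;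
    measurability is what passes integrability on to the divergence itself.\<close>
  have vec_div_meas: "vec_div W \<in> borel_measurable borel"
    unfolding vec_div_def[abs_def]
    by (intro borel_measurable_continuous_onI continuous_on_sum continuous_on_partial_deriv W_C1)
  have "integrable lborel (\<lambda>x. \<bar>vec_div W x\<bar>)"
    using moments(1) p_inv(3) unfolding mean_finite_def div_W l_def[abs_def, symmetric]
    by (simp add: abs_mult less_imp_le mult.commute)
  then have int_W: "integrable lborel (vec_div W)"
    using integrable_abs_iff[of "vec_div W" lborel] vec_div_meas by simp
  have conts: "continuous_on UNIV h" "continuous_on UNIV p" "continuous_on UNIV g"
    using C1_map_imp_continuous smooth C2_map_imp_C1_map C(5) by blast+
  have "continuous_on UNIV (gradient l)"
    unfolding gradient_def[abs_def]
    by (intro continuous_on_vec_lambda continuous_on_partial_deriv C2_map_imp_C1_map C)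
  \<comment> \<open>\<open>psi\<close> is written out in coordinates so that the continuity rules
    apply.\<close>
  then have "continuous_on UNIV (\<lambda>x. \<chi> k. \<Sum>j\<in>UNIV. g x $ j $ k * gradient l x $ j)"
    by (intro continuous_intros conts)
  also have "(\<lambda>x. \<chi> k. \<Sum>j\<in>UNIV. g x $ j $ k * gradient l x $ j) = psi"
    by (simp add: psi fun_eq_iff matrix_vector_mult_def transpose_def)
  finally have "continuous_on UNIV psi" .
  with conts have [measurable]:
    "h \<in> borel_measurable borel" "p \<in> borel_measurable borel" "psi \<in> borel_measurable borel"
    by (auto intro: borel_measurable_continuous_onI)
  have "integrable lborel (\<lambda>x. (norm (h x))\<^sup>2 * p x + (norm (psi x))\<^sup>2 * p x)"
    using moments(2,3) unfolding mean_finite_def by (rule Bochner_Integration.integrable_add)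
  then have int_\<xi>: "integrable lborel (\<lambda>x. \<xi> x * p x)"
  proof (rule Bochner_Integration.integrable_bound)
    show "(\<lambda>x. \<xi> x * p x) \<in> borel_measurable lborel" unfolding \<xi>_def by measurable
    \<comment> \<open>Cauchy-Schwarz and the arithmetic-geometric mean inequality bound the inner
      product by half the sum of the squares, which leaves room for the other half of the squared
      norm of \<open>psi\<close>.\<close>
    have "\<bar>\<xi> x\<bar> \<le> (norm (h x))\<^sup>2 + (norm (psi x))\<^sup>2" for x
    proof -
      have "2 * \<bar>h x \<bullet> psi x\<bar> \<le> 2 * (norm (h x) * norm (psi x))"
        using Cauchy_Schwarz_ineq2[of "h x" "psi x"] by simp
      also have "\<dots> \<le> (norm (h x))\<^sup>2 + (norm (psi x))\<^sup>2"
        using sum_squares_bound[of "norm (h x)" "norm (psi x)"] by simp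
      finally have "2 * \<bar>h x \<bullet> psi x\<bar> \<le> (norm (h x))\<^sup>2 + (norm (psi x))\<^sup>2" .
      moreover have "0 \<le> (norm (h x))\<^sup>2" by simp
      moreover have "0 \<le> (norm (psi x))\<^sup>2" by simp
      ultimately show ?thesis unfolding \<xi>_def by arith
    qed
    then have "\<bar>\<xi> x\<bar> * p x \<le> ((norm (h x))\<^sup>2 + (norm (psi x))\<^sup>2) * p x" for x
      using p_inv(3)[of x] by (intro mult_right_mono) auto
    then show "AE x in lborel. norm (\<xi> x * p x)
        \<le> norm ((norm (h x))\<^sup>2 * p x + (norm (psi x))\<^sup>2 * p x)"
      using p_inv(3) by (simp add: abs_mult less_imp_le distrib_right)
  qed
  have "vec_div W0 = (\<lambda>x. vec_div W x - \<xi> x * p x)" using \<xi>_p by auto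
  then have int_W0: "integrable lborel (vec_div W0)"
    using int_W int_\<xi> by simp
  have "(\<integral>x. \<xi> x * p x \<partial>lborel) = integral\<^sup>L lborel (vec_div W) - integral\<^sup>L lborel (vec_div W0)"
    unfolding \<xi>_p using int_W int_W0 by simp
  also have "\<dots> = 0"
    using integral_vec_div_eq_0[OF W_C1(1) int_W W_decay(1)]
      integral_vec_div_eq_0[OF W_C1(2) int_W0 W_decay(2)] by simp
  finally show ?thesis
    using int_\<xi> unfolding mean_finite_def mean_def \<xi>_def by simp
qed

end
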